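(* For a digit $d \in \{0, 1, \dots, 9\}$ and an integer $r \geq 0$, let $\sigma_d(r)$ denote the sum of the reciprocals of all positive integers whose decimal representation contains the digit $d$ exactly $r$ times. Then for every $d \in \{0, 1, \dots, 9\}$, the sequence $(\sigma_d(r))_{r \geq 1}$ is decreasing and converges to $10 \log 10$.
   Context: $\log$ denotes the natural logarithm. Decimal representations of positive integers are taken without leading zeros. The series defining $\sigma_d(r)$ is convergent for every $d$ and $r$. *)

theory Defs
  imports "HOL-Analysis.Analysis"
begin

text \<open>Digits in base ten, least significant first. A positive integer gets no leading zeros,
  see \<open>decimal_digits_correct\<close> below; \<open>0\<close> has the empty expansion.\<close>

fun decimal_digits :: "nat \<Rightarrow> nat list" where
  "decimal_digits n = (if n = 0 then [] else (n mod 10) # decimal_digits (n div 10))"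

declare decimal_digits.simps [simp del]

lemma decimal_digits_correct:
  "horner_sum (\<lambda>a. a) 10 (decimal_digits n) = n"
  "set (decimal_digits n) \<subseteq> {0..9}"
  "n > 0 \<Longrightarrow> decimal_digits n \<noteq> [] \<and> last (decimal_digits n) \<noteq> 0"
proof (induction n rule: decimal_digits.induct)
  case (1 n)
  {
    case 1
    show ?case using "1.IH"(1) by (subst decimal_digits.simps) (auto simp: algebra_simps)
  next
    case 2
    have "n mod 10 \<le> 9" by simp
    then show ?case using "1.IH"(2) by (subst decimal_digits.simps) auto
  next
    case 3
    show ?case
    proof (cases "n div 10 = 0")
      case True
      then have "decimal_digits n = [n]"
        using 3 by (subst decimal_digits.simps) (simp add: decimal_digits.simps[of 0] div_eq_0_iff)
      then show ?thesis using 3 by simp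
    next
      case False
      then show ?thesis using "1.IH"(3) 3 by (subst (1 2) decimal_digits.simps) auto
    qed
  }
qed

text \<open>The unordered sum is adequate because all terms are positive. (\<open>infsum\<close> would be \<open>0\<close> if the
  series diverged; it converges for all digits \<open>d\<close> and all \<open>r\<close>.)\<close>

definition sigma :: "nat \<Rightarrow> nat \<Rightarrow> real" where
  "sigma d r = (\<Sum>\<^sub>\<infinity> n \<in> {n. n > 0 \<and> count_list (decimal_digits n) d = r}. 1 / real n)"

end

theory Submission
  imports Defs
begin

text \<open>Removing the last digit maps an integer with \<open>r\<close> digits \<open>d\<close> to one with \<open>r\<close> or, if that
  digit is \<open>d\<close>, with \<open>r - 1\<close> digits \<open>d\<close>. Since \<open>1 / (10 * m + a) \<le> 1 / (10 * m)\<close>, this gives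
  \<open>10 * \<sigma> r < 9 * \<sigma> r + \<sigma> (r - 1)\<close> for \<open>r \<ge> 2\<close>, which is the monotonicity. The function
  \<open>L n = ln (1 + 1 / n)\<close> satisfies \<open>L m = (\<Sum>a<10. L (10 * m + a))\<close>, so all terms with a last digit
  other than \<open>d\<close> cancel, and the sum of \<open>L (10 * m + d)\<close> over the \<open>m\<close> with exactly \<open>r\<close> digits \<open>d\<close>
  does not depend on \<open>r \<ge> 1\<close>: it is \<open>L 1 + \<dots> + L 9 = ln 10\<close>. As \<open>10 * L (10 * m + d)\<close> differs
  from \<open>1 / m\<close> by at most \<open>1 / m\<^sup>2 \<le> 1 / (r * m)\<close>, the limit follows.\<close>

section \<open>Integers with a prescribed number of digits \<open>d\<close>\<close>

definition exact_digits :: "nat \<Rightarrow> nat \<Rightarrow> nat set" where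
  "exact_digits d r = {n. n > 0 \<and> count_list (decimal_digits n) d = r}"

lemma count_decimal_digits_append:
  assumes "m > 0" "a < 10"
  shows "count_list (decimal_digits (10 * m + a)) d
    = count_list (decimal_digits m) d + of_bool (a = d)"
  using assms by (subst decimal_digits.simps) auto

lemma count_decimal_digits_single:
  assumes "0 < a" "a < 10"
  shows "count_list (decimal_digits a) d = of_bool (a = d)"
proof -
  have "decimal_digits a = [a]"
    using assms by (subst decimal_digits.simps) (simp add: decimal_digits.simps[of 0])
  then show ?thesis by simp
qed

text \<open>This crude bound is enough for the limit: every term of the series for \<open>r\<close>
  then has \<open>1 / n\<close> at most \<open>1 / r\<close>.\<close>

lemma count_decimal_digits_le: "count_list (decimal_digits n) d \<le> n"
proof (induction n rule: less_induct)
  case (less n)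
  show ?case
  proof (cases "n = 0")
    case True
    then show ?thesis by (simp add: decimal_digits.simps)
  next
    case False
    then have "count_list (decimal_digits (n div 10)) d \<le> n div 10"
      by (intro less) simp
    moreover have "n div 10 + 1 \<le> n" using False by simp
    ultimately show ?thesis using False by (subst decimal_digits.simps) simp
  qed
qed

lemma exact_digits_ge: "n \<in> exact_digits d r \<Longrightarrow> r \<le> n"
  using count_decimal_digits_le by (auto simp: exact_digits_def)

lemma exact_digits_pos: "n \<in> exact_digits d r \<Longrightarrow> 0 < n"
  by (simp add: exact_digits_def)

lemma exact_digits_append_other:
  assumes "a < 10" "a \<noteq> d"
  shows "{m. m > 0 \<and> 10 * m + a \<in> exact_digits d r} = exact_digits d r"
  using assms by (auto simp: exact_digits_def count_decimal_digits_append)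

lemma exact_digits_append_same:
  assumes "d < 10"
  shows "{m. m > 0 \<and> 10 * m + d \<in> exact_digits d (Suc r)} = exact_digits d r"
    and "{m. m > 0 \<and> 10 * m + d \<in> exact_digits d 0} = {}"
  using assms by (auto simp: exact_digits_def count_decimal_digits_append)

lemma exact_digits_small:
  "{1..9} \<inter> exact_digits d r = {a\<in>{1..9}. of_bool (a = d) = r}"
  by (auto simp: exact_digits_def count_decimal_digits_single)

text \<open>A single element of each set is what makes the comparison of the series in
  \<open>sigma_Suc_less\<close> strict.\<close>

lemma exact_digits_nonempty: "\<exists>n. n \<in> exact_digits d r" if "d < 10"
proof (induction r)
  case 0
  have "(if d = 1 then 2 else 1) \<in> exact_digits d 0"
    by (auto simp: exact_digits_def count_decimal_digits_single)
  then show ?case by blast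
next
  case (Suc r)
  then obtain n where "n \<in> exact_digits d r" by blast
  then have "10 * n + d \<in> exact_digits d (Suc r)"
    using exact_digits_append_same(1)[OF that] by blast
  then show ?case by blast
qed

section \<open>Splitting series by the last digit\<close>

text \<open>Every integer from 10 on is \<open>10 * m + a\<close> for exactly one
  \<open>m > 0\<close> and \<open>a < 10\<close>; the one-digit integers remain as a separate finite
  sum.\<close>

lemma infsum_split_last_digit:
  fixes f :: "nat \<Rightarrow> real"
  assumes X: "0 \<notin> X" and f: "f summable_on X"
  shows "infsum f X = sum f ({1..9} \<inter> X)
    + (\<Sum>a<10. \<Sum>\<^sub>\<infinity>m\<in>{m. m > 0 \<and> 10 * m + a \<in> X}. f (10 * m + a))"
proof -
  define A where "A a = (\<lambda>m. 10 * m + a) ` {m. m > 0 \<and> 10 * m + a \<in> X}" for a :: nat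
  have inj: "inj_on (\<lambda>m. 10 * m + a) M" for a :: nat and M by (simp add: inj_on_def)
  have sub: "A a \<subseteq> X" for a by (auto simp: A_def)
  have "(f has_sum (\<Sum>a<10. infsum f (A a))) (\<Union>a\<in>{..<10}. A a)"
  proof (rule sum_has_sum)
    show "(f has_sum infsum f (A a)) (A a)" for a
      using summable_on_subset_banach[OF f sub] by simp
    show "A a \<inter> A b = {}" if "a \<in> {..<10}" "b \<in> {..<10}" "a \<noteq> b" for a b
      using that unfolding A_def by auto presburger
  qed simp
  moreover have "(f has_sum sum f ({1..9} \<inter> X)) ({1..9} \<inter> X)" by simp
  moreover have "({1..9} \<inter> X) \<inter> (\<Union>a\<in>{..<10}. A a) = {}" by (auto simp: A_def)
  ultimately have "(f has_sum (sum f ({1..9} \<inter> X) + (\<Sum>a<10. infsum f (A a))))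
      (({1..9} \<inter> X) \<union> (\<Union>a\<in>{..<10}. A a))"
    by (intro has_sum_Un_disjoint)
  moreover have "({1..9} \<inter> X) \<union> (\<Union>a\<in>{..<10}. A a) = X"
  proof (intro equalityI subsetI)
    fix n assume n: "n \<in> X"
    show "n \<in> ({1..9} \<inter> X) \<union> (\<Union>a\<in>{..<10}. A a)"
    proof (cases "n < 10")
      case True
      moreover have "n > 0" using n X by (cases n) auto
      ultimately show ?thesis using n by auto
    next
      case False
      then have "n \<in> A (n mod 10)"
        unfolding A_def using n by (intro image_eqI[of _ _ "n div 10"]) auto
      then show ?thesis by (intro UnI2 UN_I[of "n mod 10"]) auto
    qed
  qed (use sub in auto)
  moreover have "infsum f (A a) = (\<Sum>\<^sub>\<infinity>m\<in>{m. m > 0 \<and> 10 * m + a \<in> X}. f (10 * m + a))" for a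
    unfolding A_def by (subst infsum_reindex[OF inj]) (simp add: o_def)
  ultimately show ?thesis by (simp add: infsumI)
qed

lemma sum_remove_digit:
  fixes g :: "nat \<Rightarrow> real"
  assumes "d < 10"
  shows "(\<Sum>a<10. g a) = g d + (\<Sum>a\<in>{..<10} - {d}. g a)"
  using assms by (intro sum.remove) auto

text \<open>Dropping a last digit other than \<open>d\<close> keeps the count, dropping
  \<open>d\<close> lowers it by one. For \<open>r = 0\<close> no last digit \<open>d\<close> is
  possible, hence the value \<open>0\<close> in that case.\<close>

lemma infsum_exact_digits:
  fixes f :: "nat \<Rightarrow> real"
  assumes d: "d < 10" and f: "f summable_on exact_digits d r"
  shows "infsum f (exact_digits d r) = sum f {a\<in>{1..9}. of_bool (a = d) = r}
    + (\<Sum>a\<in>{..<10} - {d}. \<Sum>\<^sub>\<infinity>m\<in>exact_digits d r. f (10 * m + a))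
    + (case r of 0 \<Rightarrow> 0 | Suc s \<Rightarrow> \<Sum>\<^sub>\<infinity>m\<in>exact_digits d s. f (10 * m + d))"
proof -
  have "0 \<notin> exact_digits d r" by (simp add: exact_digits_def)
  then have "infsum f (exact_digits d r) = sum f {a\<in>{1..9}. of_bool (a = d) = r}
    + (\<Sum>a<10. \<Sum>\<^sub>\<infinity>m\<in>{m. m > 0 \<and> 10 * m + a \<in> exact_digits d r}. f (10 * m + a))"
    using infsum_split_last_digit f unfolding exact_digits_small[symmetric] by blast
  moreover have "(\<Sum>a\<in>{..<10} - {d}.
      \<Sum>\<^sub>\<infinity>m\<in>{m. m > 0 \<and> 10 * m + a \<in> exact_digits d r}. f (10 * m + a))
    = (\<Sum>a\<in>{..<10} - {d}. \<Sum>\<^sub>\<infinity>m\<in>exact_digits d r. f (10 * m + a))"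
    by (intro sum.cong refl) (subst exact_digits_append_other, auto)
  moreover have "(\<Sum>\<^sub>\<infinity>m\<in>{m. m > 0 \<and> 10 * m + d \<in> exact_digits d r}. f (10 * m + d))
    = (case r of 0 \<Rightarrow> 0 | Suc s \<Rightarrow> \<Sum>\<^sub>\<infinity>m\<in>exact_digits d s. f (10 * m + d))"
    by (cases r) (simp_all only: exact_digits_append_same[OF d] infsum_empty nat.case)
  ultimately show ?thesis
    unfolding sum_remove_digit[OF d] by linarith
qed

section \<open>Convergence of the series\<close>

text \<open>Cutting off at powers of ten fits the induction, since dropping a digit leads from below
  \<open>10 ^ Suc k\<close> to below \<open>10 ^ k\<close>. The constant is chosen so that the step
  closes: the one-digit integers give at most 9, each of the nine other digits
  \<open>9 * (r + 1)\<close>, and \<open>d\<close> itself \<open>9 * r\<close>, in total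
  \<open>90 * (r + 1)\<close>.\<close>

lemma sum_inverse_exact_digits_bound:
  assumes d: "d < 10"
  shows "(\<Sum>n\<in>exact_digits d r \<inter> {..<10 ^ k}. 1 / real n) \<le> 90 * real (Suc r)"
proof (induction r arbitrary: k rule: less_induct)
  case (less r)
  show ?case
  proof (induction k)
    case 0
    have "exact_digits d r \<inter> {..<10 ^ 0} = {}" by (auto simp: exact_digits_def)
    then show ?case by simp
  next
    case (Suc k)
    define X where "X = exact_digits d r \<inter> {..<10 ^ Suc k}"
    define Y where "Y a = {m. m > 0 \<and> 10 * m + a \<in> X}" for a
    have [simp]: "finite X" by (simp add: X_def)
    have Y: "Y a = {m. m > 0 \<and> 10 * m + a \<in> exact_digits d r} \<inter> {..<10 ^ k}" if "a < 10" for a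
      using that by (auto simp: Y_def X_def)
    have [simp]: "finite (Y a)" if "a < 10" for a
      using Y[OF that] by simp
    have step: "(\<Sum>m\<in>Y a. 1 / real (10 * m + a)) \<le> (\<Sum>m\<in>Y a. 1 / real m) / 10" for a
      unfolding sum_divide_distrib by (intro sum_mono) (auto simp: Y_def field_simps)
    have other: "(\<Sum>m\<in>Y a. 1 / real (10 * m + a)) \<le> 9 * real (Suc r)" if "a \<in> {..<10} - {d}" for a
    proof -
      have "Y a = exact_digits d r \<inter> {..<10 ^ k}"
        using Y[of a] exact_digits_append_other[of a d r] that by auto
      then show ?thesis using step[of a] Suc by simp
    qed
    have same: "(\<Sum>m\<in>Y d. 1 / real (10 * m + d)) \<le> 9 * real r"
    proof (cases r)
      case 0
      then have "Y d = {}" using Y[OF d] exact_digits_append_same[OF d] by simp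
      then show ?thesis by simp
    next
      case (Suc s)
      then have "Y d = exact_digits d s \<inter> {..<10 ^ k}"
        using Y[OF d] exact_digits_append_same[OF d] by simp
      then show ?thesis using step[of d] less[of s k] Suc by simp
    qed
    have "sum (\<lambda>n. 1 / real n) ({1..9} \<inter> X) \<le> (\<Sum>n\<in>{1..9::nat}. 1)"
      by (intro order.trans[OF sum_mono2[of "{1..9}"] sum_mono]) auto
    moreover have "(\<Sum>n\<in>X. 1 / real n) = sum (\<lambda>n. 1 / real n) ({1..9} \<inter> X)
        + (\<Sum>a<10. \<Sum>m\<in>Y a. 1 / real (10 * m + a))"
      \<comment> \<open>On the finite set \<open>X\<close> summability is automatic and
        \<open>infsum\<close> is an ordinary sum.\<close>
      using infsum_split_last_digit[of X "\<lambda>n. 1 / real n"]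
      by (simp add: Y_def[symmetric]) (simp add: X_def exact_digits_def)
    moreover have "(\<Sum>a\<in>{..<10} - {d}. \<Sum>m\<in>Y a. 1 / real (10 * m + a))
        \<le> (\<Sum>a\<in>{..<10} - {d}. 9 * real (Suc r))"
      by (intro sum_mono other)
    ultimately show ?case
      using same d unfolding sum_remove_digit[OF d] X_def[symmetric] by simp
  qed
qed

lemma inverse_summable_on_exact_digits:
  assumes "d < 10"
  shows "(\<lambda>n. 1 / real n) summable_on exact_digits d r"
proof (rule nonneg_bdd_above_summable_on)
  show "bdd_above (sum (\<lambda>n. 1 / real n) ` {F. F \<subseteq> exact_digits d r \<and> finite F})"
  proof (rule bdd_aboveI2)
    fix F assume F: "F \<in> {F. F \<subseteq> exact_digits d r \<and> finite F}"
    then obtain N where N: "F \<subseteq> {..<N}"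
      using finite_nat_iff_bounded by auto
    have "n < 10 ^ n" for n :: nat by (rule less_exp[THEN less_le_trans]) (simp add: power_mono)
    then have "F \<subseteq> exact_digits d r \<inter> {..<10 ^ N}"
      using F N by (auto intro: less_trans)
    then have "(\<Sum>n\<in>F. 1 / real n) \<le> (\<Sum>n\<in>exact_digits d r \<inter> {..<10 ^ N}. 1 / real n)"
      by (intro sum_mono2) auto
    also note sum_inverse_exact_digits_bound[OF assms]
    finally show "(\<Sum>n\<in>F. 1 / real n) \<le> 90 * real (Suc r)" .
  qed
qed simp

lemma summable_on_exact_digits:
  fixes f :: "nat \<Rightarrow> real"
  assumes "d < 10" and "\<And>n. n > 0 \<Longrightarrow> 0 \<le> f n" and "\<And>n. n > 0 \<Longrightarrow> f n \<le> 1 / real n"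
  shows "f summable_on exact_digits d r"
  by (rule summable_on_comparison_test[OF inverse_summable_on_exact_digits[of d]])
    (use assms exact_digits_pos in auto)

section \<open>Monotonicity\<close>

lemma sigma_altdef: "sigma d r = (\<Sum>\<^sub>\<infinity>n\<in>exact_digits d r. 1 / real n)"
  by (simp add: sigma_def exact_digits_def)

lemma sigma_Suc_less:
  assumes d: "d < 10" and r: "r \<ge> 1"
  shows "sigma d (Suc r) < sigma d r"
proof -
  let ?S = "exact_digits d (Suc r)"
  have summ: "(\<lambda>m. 1 / real (10 * m + a)) summable_on exact_digits d s" for a s
    by (rule summable_on_exact_digits[OF d]) (auto simp: field_simps)
  have summ': "(\<lambda>m. (1 / 10) * (1 / real m)) summable_on exact_digits d s" for s
    by (intro summable_on_cmult_right inverse_summable_on_exact_digits d)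
  have le: "(\<Sum>\<^sub>\<infinity>m\<in>exact_digits d s. 1 / real (10 * m + a)) \<le> (1 / 10) * sigma d s" for a s
    unfolding sigma_altdef infsum_cmult_right'[symmetric]
    by (intro infsum_mono summ summ') (auto simp: field_simps dest: exact_digits_pos)
  \<comment> \<open>A nonzero last digit other than \<open>d\<close>: as
    \<open>10 * m + b > 10 * m\<close>, this one digit already makes the estimate strict.\<close>
  define b where "b = (if d = 1 then 2 else 1 :: nat)"
  have b: "b \<in> {..<10} - {d}" "b > 0" by (auto simp: b_def)
  obtain n where n: "n \<in> ?S" using exact_digits_nonempty[OF d] by blast
  have "(\<Sum>\<^sub>\<infinity>m\<in>?S. 1 / real (10 * m + b)) < (1 / 10) * sigma d (Suc r)"
    unfolding sigma_altdef infsum_cmult_right'[symmetric]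
    by (rule has_sum_strict_mono[OF has_sum_infsum[OF summ] has_sum_infsum[OF summ'] _ n])
      (use exact_digits_pos[OF n] b in \<open>auto simp: field_simps dest: exact_digits_pos\<close>)
  then have "(\<Sum>a\<in>{..<10} - {d}. \<Sum>\<^sub>\<infinity>m\<in>?S. 1 / real (10 * m + a))
      < (\<Sum>a\<in>{..<10} - {d}. (1 / 10) * sigma d (Suc r))"
    using b le by (intro sum_strict_mono_ex1) auto
  also have "\<dots> = 9 / 10 * sigma d (Suc r)" using d by simp
  finally have "(\<Sum>a\<in>{..<10} - {d}. \<Sum>\<^sub>\<infinity>m\<in>?S. 1 / real (10 * m + a))
      < 9 / 10 * sigma d (Suc r)" .
  \<comment> \<open>A one-digit integer cannot contain \<open>d\<close> twice. This is where
    \<open>r \<ge> 1\<close> enters.\<close>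
  moreover have "{a\<in>{1..9::nat}. of_bool (a = d) = Suc r} = {}" using r by auto
  moreover note infsum_exact_digits[OF d inverse_summable_on_exact_digits[OF d], of "Suc r"] le[of d r]
  ultimately show ?thesis
    unfolding sigma_altdef[symmetric] by (simp only: sum.empty nat.case) argo
qed

section \<open>An exact evaluation with logarithms\<close>

lemma ln_one_plus_inverse_bounds:
  assumes "n > 0"
  shows "1 / (real n + 1) \<le> ln (1 + 1 / real n)" "ln (1 + 1 / real n) \<le> 1 / real n"
proof -
  show "ln (1 + 1 / real n) \<le> 1 / real n" using assms by (intro ln_add_one_self_le_self) simp
  have "ln (real n / (real n + 1)) \<le> real n / (real n + 1) - 1"
    using assms by (intro ln_le_minus_one) simp
  moreover have "ln (real n / (real n + 1)) = - ln (1 + 1 / real n)"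
    using assms by (subst ln_inverse[symmetric]) (auto simp: field_simps)
  ultimately show "1 / (real n + 1) \<le> ln (1 + 1 / real n)"
    using assms by (simp add: field_simps)
qed

lemma ln_one_plus_inverse_eq_diff: "n > 0 \<Longrightarrow> ln (1 + 1 / real n) = ln (real (Suc n)) - ln (real n)"
  by (subst ln_divide_pos[symmetric]) (auto simp: field_simps)

text \<open>The sum telescopes from \<open>ln (10 * m)\<close> to \<open>ln (10 * (m + 1))\<close>,
  and the two summands \<open>ln 10\<close> cancel.\<close>

lemma sum_ln_last_digit:
  assumes "m > 0"
  shows "(\<Sum>a<10. ln (1 + 1 / real (10 * m + a))) = ln (1 + 1 / real m)"
proof -
  have "(\<Sum>a<10. ln (1 + 1 / real (10 * m + a)))
      = (\<Sum>a<10. ln (real (10 * m + Suc a)) - ln (real (10 * m + a)))"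
    using assms by (intro sum.cong refl) (subst ln_one_plus_inverse_eq_diff, simp_all)
  also have "\<dots> = ln (real (10 * Suc m)) - ln (real (10 * m))"
    by (subst sum_lessThan_telescope) simp
  also have "\<dots> = ln (1 + 1 / real m)"
    using assms ln_mult_pos[of 10 "real m"] ln_mult_pos[of 10 "real (Suc m)"]
    by (simp add: ln_one_plus_inverse_eq_diff)
  finally show ?thesis .
qed

lemma infsum_sum_swap:
  fixes f :: "'i \<Rightarrow> 'a \<Rightarrow> real"
  assumes "finite I" and "\<And>i. i \<in> I \<Longrightarrow> f i summable_on X"
  shows "(\<Sum>\<^sub>\<infinity>x\<in>X. \<Sum>i\<in>I. f i x) = (\<Sum>i\<in>I. infsum (f i) X)"
proof -
  have "((\<lambda>x. \<Sum>i\<in>I. f i x) has_sum (\<Sum>i\<in>I. infsum (f i) X)) X"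
    using assms by (induction I rule: finite_induct) (auto intro!: has_sum_add)
  then show ?thesis by (rule infsumI)
qed

text \<open>The sum of \<open>L\<close> over \<open>exact_digits d r\<close> is expanded in two
  ways: each \<open>L m\<close> is replaced by its ten successors \<open>L (10 * m + a)\<close>, or
  the index itself is split by its last digit. Equating the two gives a recursion for
  \<open>D\<close>.\<close>

lemma infsum_ln_exact_digits:
  assumes d: "d < 10"
  shows "(\<Sum>\<^sub>\<infinity>m\<in>exact_digits d (Suc r). ln (1 + 1 / real (10 * m + d))) = ln 10"
proof -
  define L where "L n = ln (1 + 1 / real n)" for n
  define D where "D r = (\<Sum>\<^sub>\<infinity>m\<in>exact_digits d r. L (10 * m + d))" for r
  have nonneg: "L n \<ge> 0" for n by (simp add: L_def)
  have summ0: "L summable_on exact_digits d r" for r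
    using ln_one_plus_inverse_bounds nonneg by (intro summable_on_exact_digits[OF d]) (auto simp: L_def)
  have summ: "(\<lambda>m. L (10 * m + a)) summable_on exact_digits d r" for a r
  proof (rule summable_on_exact_digits[OF d])
    show "L (10 * n + a) \<le> 1 / real n" if "n > 0" for n
      using that unfolding L_def
      by (intro order.trans[OF ln_one_plus_inverse_bounds(2)]) (auto simp: field_simps)
  qed (rule nonneg)
  have "infsum L (exact_digits d r)
      = (\<Sum>\<^sub>\<infinity>m\<in>exact_digits d r. \<Sum>a<10. L (10 * m + a))" for r
    by (intro infsum_cong) (simp only: L_def sum_ln_last_digit exact_digits_pos)
  also have "\<dots> r = (\<Sum>a<10. \<Sum>\<^sub>\<infinity>m\<in>exact_digits d r. L (10 * m + a))" for r
    by (intro infsum_sum_swap summ) simp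
  finally have split: "infsum L (exact_digits d r)
      = D r + (\<Sum>a\<in>{..<10} - {d}. \<Sum>\<^sub>\<infinity>m\<in>exact_digits d r. L (10 * m + a))" for r
    unfolding sum_remove_digit[OF d] D_def .
  \<comment> \<open>The terms with \<open>a \<noteq> d\<close> are the same in both expansions and
    cancel.\<close>
  then have rec: "D r = sum L {a\<in>{1..9}. of_bool (a = d) = r} + (case r of 0 \<Rightarrow> 0 | Suc s \<Rightarrow> D s)" for r
    using split[of r] infsum_exact_digits[OF d summ0, of r] unfolding D_def[symmetric] by linarith
  \<comment> \<open>\<open>D 0\<close> collects the one-digit integers other than \<open>d\<close>,
    and the step to \<open>D (Suc 0)\<close> adds \<open>d\<close> itself if it is nonzero, so all
    of 1 to 9 occur.\<close>
  have "D (Suc 0) = sum L {a\<in>{1..9}. of_bool (a = d) = (1::nat)}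
      + sum L {a\<in>{1..9}. of_bool (a = d) = (0::nat)}"
    using rec[of 0] rec[of "Suc 0"] by (simp only: nat.case One_nat_def)
  also have "\<dots> = sum L {1..9}"
    by (subst sum.union_disjoint[symmetric]) (auto intro!: sum.cong)
  also have "\<dots> = (\<Sum>n\<in>{1..<10}. ln (real (Suc n)) - ln (real n))"
    unfolding L_def by (intro sum.cong ln_one_plus_inverse_eq_diff) auto
  also have "\<dots> = ln 10"
    by (subst sum_Suc_diff') auto
  finally have "D (Suc 0) = ln 10" .
  moreover have "D (Suc (Suc r)) = D (Suc r)" for r
    proof -
    have "{a\<in>{1..9::nat}. of_bool (a = d) = Suc (Suc r)} = {}" by auto
    then show ?thesis using rec[of "Suc (Suc r)"] by (simp only: sum.empty nat.case add_0)
  qed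
  ultimately have "D (Suc r) = ln 10"
    by (induction r) auto
  then show ?thesis by (simp only: D_def L_def)
qed

section \<open>The limit\<close>

text \<open>Both bounds come from comparing \<open>1 / m\<close> term by term with
  \<open>10 * ln (1 + 1 / (10 * m + d))\<close>, whose sum is \<open>10 * ln 10\<close>.\<close>

lemma sigma_bounds:
  assumes d: "d < 10" and r: "r \<ge> 1"
  shows "10 * ln 10 \<le> sigma d r" "(1 - 1 / real r) * sigma d r \<le> 10 * ln 10"
proof -
  let ?S = "exact_digits d r"
  let ?L = "\<lambda>m. ln (1 + 1 / real (10 * m + d))"
  have upper: "10 * ?L m \<le> 1 / real m" if "m > 0" for m
  proof -
    have "?L m \<le> 1 / real (10 * m + d)"
      using ln_one_plus_inverse_bounds(2)[of "10 * m + d"] that by simp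
    also have "\<dots> \<le> 1 / (10 * real m)" using that by (intro divide_left_mono) auto
    finally show ?thesis using that by (simp add: field_simps)
  qed
  have lower: "(1 - 1 / real r) * (1 / real m) \<le> 10 * ?L m" if m: "m \<in> ?S" for m
  proof -
    have pos: "m > 0" and ge: "r \<le> m" using m exact_digits_pos exact_digits_ge by auto
    have "1 / real m \<le> 1 / real r" using ge r by (simp add: field_simps)
    then have "(1 - 1 / real r) * (1 / real m) \<le> (1 - 1 / real m) * (1 / real m)"
      by (intro mult_right_mono) auto
    \<comment> \<open>This amounts to \<open>(m - 1) * (m + 1) \<le> m * m\<close>.\<close>
    also have "\<dots> \<le> 1 / (real m + 1)"
      using pos by (simp add: field_simps)
    also have "\<dots> = 10 * (1 / (10 * (real m + 1)))" by (simp only: divide_simps) simp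
    \<comment> \<open>Here \<open>d \<le> 9\<close> gives
      \<open>10 * m + d + 1 \<le> 10 * (m + 1)\<close>.\<close>
    also have "\<dots> \<le> 10 * (1 / (real (10 * m + d) + 1))"
      using d by (intro mult_left_mono divide_left_mono) auto
    also have "\<dots> \<le> 10 * ?L m"
      using ln_one_plus_inverse_bounds(1)[of "10 * m + d"] pos by (intro mult_left_mono) auto
    finally show ?thesis .
  qed
  have summ: "(\<lambda>m. 10 * ?L m) summable_on ?S"
    by (rule summable_on_exact_digits[OF d]) (use upper in auto)
  obtain s where s: "r = Suc s" using r by (cases r) auto
  have eq: "(\<Sum>\<^sub>\<infinity>m\<in>?S. 10 * ?L m) = 10 * ln 10"
    unfolding infsum_cmult_right' s infsum_ln_exact_digits[OF d] ..
  show "10 * ln 10 \<le> sigma d r"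
    unfolding eq[symmetric] sigma_altdef
    by (intro infsum_mono summ inverse_summable_on_exact_digits d upper exact_digits_pos)
  show "(1 - 1 / real r) * sigma d r \<le> 10 * ln 10"
    unfolding eq[symmetric] sigma_altdef infsum_cmult_right'[symmetric]
    by (intro infsum_mono summ summable_on_cmult_right inverse_summable_on_exact_digits d lower)
qed

theorem theorem2:
  fixes d :: nat
  assumes "d \<in> {0..9}"
  shows "strict_antimono_on {1..} (sigma d) \<and> sigma d \<longlonglongrightarrow> 10 * ln 10"
proof
  have d: "d < 10" using assms by simp
  show "strict_antimono_on {1..} (sigma d)"
  proof (rule monotone_onI)
    fix r s :: nat
    assume "r \<in> {1..}" "s \<in> {1..}" "r < s"
    then show "sigma d s < sigma d r"
    proof (induction s)
      case (Suc s)
      then have less: "sigma d (Suc s) < sigma d s" by (intro sigma_Suc_less[OF d]) simp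
      show ?case
      proof (cases "r = s")
        case False
        then have "sigma d s < sigma d r" using Suc by simp
        with less show ?thesis by simp
      qed (use less in simp)
    qed simp
  qed
  show "sigma d \<longlonglongrightarrow> 10 * ln 10"
  proof (rule tendsto_sandwich)
    show "\<forall>\<^sub>F r in sequentially. 10 * ln 10 \<le> sigma d r"
      using eventually_ge_at_top[of 1] by eventually_elim (rule sigma_bounds(1)[OF d])
    show "\<forall>\<^sub>F r in sequentially. sigma d r \<le> 10 * ln 10 / (1 - 1 / real r)"
      \<comment> \<open>At \<open>r = 1\<close> the denominator vanishes, and the quotient would be
        \<open>0\<close> by convention.\<close>
      using eventually_ge_at_top[of 2]
    proof eventually_elim
      case (elim r)
      then have "(1 - 1 / real r) * sigma d r \<le> 10 * ln 10" by (intro sigma_bounds(2)[OF d]) simp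
      moreover have "1 - 1 / real r > 0" using elim by simp
      ultimately show ?case by (simp add: pos_le_divide_eq mult.commute)
    qed
    have "(\<lambda>r. 10 * ln 10 / (1 - 1 / real r)) \<longlonglongrightarrow> 10 * ln 10 / (1 - 0)"
      by (intro tendsto_intros lim_1_over_n) simp
    then show "(\<lambda>r. 10 * ln 10 / (1 - 1 / real r)) \<longlonglongrightarrow> 10 * ln 10" by simp
  qed simp
qed

end
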